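(* Let $I,X,Y$ be nonempty sets, $\mathbf C$ a nonempty set of functions $I\to X$, $\Omega$ a nonempty set of functions $I\to Y$, and $\mathcal X$ a nonempty family of subsets of $I$. Let $\mathbf M=\mathcal P(\mathbf C)^{\Omega}$, $\mathcal M\in\mathbf M$ and $\mathbf M_{\mathcal M}=\{\phi\in\mathbf M\mid\phi\sqsubseteq\mathcal M\}$. Define $\gamma:\mathbf M_{\mathcal M}\to\mathbf M_{\mathcal M}$ by $$\gamma(\phi)(\omega)=\bigcap_{A\in\mathcal X}\ \bigcup_{\substack{h\in\mathbf C\\ h|_A\in[\phi](-\omega|A)}}\phi(\omega)(h|A),\qquad \phi\in\mathbf M_{\mathcal M},\ \omega\in\Omega.$$ Then $\gamma$ is isotone ($\phi\sqsubseteq\psi$ implies $\gamma(\phi)\sqsubseteq\gamma(\psi)$) and restrictive ($\gamma(\phi)\sqsubseteq\phi$ for all $\phi$) on $(\mathbf M_{\mathcal M},\sqsubseteq)$, and the set of its fixed points $\{\phi\in\mathbf M_{\mathcal M}\mid\gamma(\phi)=\phi\}$ is exactly the set of all $\mathcal X$-non-anticipating $\phi\in\mathbf M_{\mathcal M}$.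
   Context: $\mathcal P(Z)$ is the power set of $Z$; $\mathbf M$ is the set of all multifunctions $\phi:\Omega\to\mathcal P(\mathbf C)$, ordered by $\phi\sqsubseteq\psi$ iff $\phi(\omega)\subset\psi(\omega)$ for all $\omega\in\Omega$. For a function $f$ on $I$ and $A\subset I$, $f|_A$ is its restriction to $A$; for a set $F$ of functions on $I$, $(F|A)=\{f|_A: f\in F\}$. For $\omega\in\Omega$, $H\subset\mathbf C$, $h\in\mathbf C$: $\Omega(\omega|A)=\{\nu\in\Omega\mid\nu|_A=\omega|_A\}$, $\Omega(-\omega|A)=\Omega(\omega|A)\setminus\{\omega\}$, $H(h|A)=\{f\in H\mid f|_A=h|_A\}$ (used with $H=\phi(\omega)$). For $\phi\in\mathbf M$, $[\phi](-\omega|A)=\bigcap_{\nu\in\Omega(-\omega|A)}(\phi(\nu)|A)$, where the intersection over the empty index set is taken to be $(\mathbf C|A)$. A multifunction $\phi\in\mathbf M$ is $\mathcal X$-non-anticipating iff for all $A\in\mathcal X$ and $\omega,\omega'\in\Omega$ with $\omega'|_A=\omega|_A$ one has $(\phi(\omega)|A)\subset(\phi(\omega')|A)$. *)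

theory Defs
  imports Main "HOL-Library.FuncSet"
begin

text \<open>
  Functions on a set are extensional functions (\<^const>\<open>PiE\<close>), so that equality of functions
  on a set is HOL equality, and f restricted to A is \<^term>\<open>restrict f A\<close>.
\<close>

definition restr_set :: "('i \<Rightarrow> 'x) set \<Rightarrow> 'i set \<Rightarrow> ('i \<Rightarrow> 'x) set" where
  "restr_set F A = (\<lambda>f. restrict f A) ` F"

text \<open>Gives both \<open>\<Omega>(\<omega>|A)\<close> and \<open>H(h|A)\<close>.\<close>

definition agreeing :: "('i \<Rightarrow> 'x) set \<Rightarrow> ('i \<Rightarrow> 'x) \<Rightarrow> 'i set \<Rightarrow> ('i \<Rightarrow> 'x) set" where
  "agreeing H h A = {f \<in> H. restrict f A = restrict h A}"

definition agreeing_others :: "('i \<Rightarrow> 'y) set \<Rightarrow> ('i \<Rightarrow> 'y) \<Rightarrow> 'i set \<Rightarrow> ('i \<Rightarrow> 'y) set" where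
  "agreeing_others \<Omega> \<omega> A = agreeing \<Omega> \<omega> A - {\<omega>}"

type_synonym ('i, 'x, 'y) multifun = "('i \<Rightarrow> 'y) \<Rightarrow> ('i \<Rightarrow> 'x) set"

definition multifunctions ::
    "('i \<Rightarrow> 'x) set \<Rightarrow> ('i \<Rightarrow> 'y) set \<Rightarrow> ('i, 'x, 'y) multifun set" where
  "multifunctions C \<Omega> = (\<Omega> \<rightarrow>\<^sub>E Pow C)"

definition multi_le ::
    "('i \<Rightarrow> 'y) set \<Rightarrow> ('i, 'x, 'y) multifun \<Rightarrow> ('i, 'x, 'y) multifun \<Rightarrow> bool" where
  "multi_le \<Omega> \<phi> \<psi> \<longleftrightarrow> (\<forall>\<omega>\<in>\<Omega>. \<phi> \<omega> \<subseteq> \<psi> \<omega>)"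

definition multifunctions_below ::
    "('i \<Rightarrow> 'x) set \<Rightarrow> ('i \<Rightarrow> 'y) set \<Rightarrow> ('i, 'x, 'y) multifun \<Rightarrow> ('i, 'x, 'y) multifun set" where
  "multifunctions_below C \<Omega> \<M> = {\<phi> \<in> multifunctions C \<Omega>. multi_le \<Omega> \<phi> \<M>}"

text \<open>\<open>[\<phi>](-\<omega>|A)\<close>; an intersection over the empty index set is \<open>(C|A)\<close>, not \<^const>\<open>UNIV\<close>.\<close>

definition bracket ::
    "('i \<Rightarrow> 'x) set \<Rightarrow> ('i \<Rightarrow> 'y) set \<Rightarrow> ('i, 'x, 'y) multifun \<Rightarrow> ('i \<Rightarrow> 'y) \<Rightarrow> 'i set
      \<Rightarrow> ('i \<Rightarrow> 'x) set" where
  "bracket C \<Omega> \<phi> \<omega> A =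
     (if agreeing_others \<Omega> \<omega> A = {} then restr_set C A
      else (\<Inter>\<nu>\<in>agreeing_others \<Omega> \<omega> A. restr_set (\<phi> \<nu>) A))"

definition non_anticipating ::
    "('i \<Rightarrow> 'y) set \<Rightarrow> 'i set set \<Rightarrow> ('i, 'x, 'y) multifun \<Rightarrow> bool" where
  "non_anticipating \<Omega> \<X> \<phi> \<longleftrightarrow>
     (\<forall>A\<in>\<X>. \<forall>\<omega>\<in>\<Omega>. \<forall>\<omega>'\<in>\<Omega>. restrict \<omega>' A = restrict \<omega> A \<longrightarrow>
        restr_set (\<phi> \<omega>) A \<subseteq> restr_set (\<phi> \<omega>') A)"

definition gamma ::
    "('i \<Rightarrow> 'x) set \<Rightarrow> ('i \<Rightarrow> 'y) set \<Rightarrow> 'i set set \<Rightarrow> ('i, 'x, 'y) multifun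
      \<Rightarrow> ('i, 'x, 'y) multifun \<Rightarrow> ('i, 'x, 'y) multifun" where
  "gamma C \<Omega> \<X> \<M> =
     (\<lambda>\<phi>\<in>multifunctions_below C \<Omega> \<M>. \<lambda>\<omega>\<in>\<Omega>.
        \<Inter>A\<in>\<X>. \<Union>h\<in>{h \<in> C. restrict h A \<in> bracket C \<Omega> \<phi> \<omega> A}. agreeing (\<phi> \<omega>) h A)"

end

theory Submission
  imports Defs
begin

text \<open>
  The operator \<open>\<gamma>\<close> filters pointwise: it keeps a response \<open>f \<in> \<phi>(\<omega>)\<close> exactly when, for
  every \<open>A \<in> \<X>\<close>, each \<open>\<nu> \<in> \<Omega>\<close> that looks like \<open>\<omega>\<close> on \<open>A\<close> admits some response that looks
  like \<open>f\<close> on \<open>A\<close> (lemma \<open>mem_gamma_iff\<close>). The exclusion of \<open>\<omega>\<close> itself in \<open>[\<phi>](-\<omega>|A)\<close> and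
  the convention for the empty intersection disappear in this description, because \<open>f\<close> is its
  own witness at \<open>\<nu> = \<omega>\<close>.

  In this form the theorem can be read off. A filter is restrictive; its condition only becomes
  weaker when \<open>\<phi>\<close> grows, so it is isotone; and \<open>\<phi>\<close> is fixed iff every \<open>f \<in> \<phi>(\<omega>)\<close> passes,
  which is the definition of non-anticipation with the inclusion of restricted sets written
  elementwise.
\<close>

lemma mem_bracket_iff:
  assumes "f \<in> C"
  shows "restrict f A \<in> bracket C \<Omega> \<phi> \<omega> A \<longleftrightarrow>
    (\<forall>\<nu>\<in>agreeing_others \<Omega> \<omega> A. restrict f A \<in> restr_set (\<phi> \<nu>) A)"
  using assms by (auto simp: bracket_def restr_set_def)

text \<open>
  For \<open>f \<in> \<phi>(\<omega>)\<close>, belonging to the union over \<open>h\<close> depends only on the class of \<open>h\<close> under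
  agreement on \<open>A\<close>, so \<open>h = f\<close> can be chosen; this is where \<open>\<phi>(\<omega>) \<subseteq> C\<close> enters. Nonemptiness
  of \<open>\<X>\<close> is what makes the outer intersection lie inside \<open>\<phi>(\<omega>)\<close>.
\<close>

lemma mem_gamma_iff:
  assumes \<phi>: "\<phi> \<in> multifunctions_below C \<Omega> \<M>" and "\<omega> \<in> \<Omega>" and "\<X> \<noteq> {}"
  shows "f \<in> gamma C \<Omega> \<X> \<M> \<phi> \<omega> \<longleftrightarrow>
    f \<in> \<phi> \<omega> \<and> (\<forall>A\<in>\<X>. \<forall>\<nu>\<in>\<Omega>. restrict \<nu> A = restrict \<omega> A \<longrightarrow>
      restrict f A \<in> restr_set (\<phi> \<nu>) A)"
proof -
  have sub: "\<phi> \<omega> \<subseteq> C"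
    using \<phi> \<open>\<omega> \<in> \<Omega>\<close> by (auto simp: multifunctions_below_def multifunctions_def)
  have "f \<in> gamma C \<Omega> \<X> \<M> \<phi> \<omega> \<longleftrightarrow>
      (\<forall>A\<in>\<X>. f \<in> \<phi> \<omega> \<and> (\<exists>h\<in>C. restrict h A \<in> bracket C \<Omega> \<phi> \<omega> A \<and> restrict f A = restrict h A))"
    using \<phi> \<open>\<omega> \<in> \<Omega>\<close> by (auto simp: gamma_def agreeing_def)
  also have "\<dots> \<longleftrightarrow> f \<in> \<phi> \<omega> \<and> (\<forall>A\<in>\<X>. restrict f A \<in> bracket C \<Omega> \<phi> \<omega> A)"
    using sub \<open>\<X> \<noteq> {}\<close> by (metis all_not_in_conv subsetD)
  also have "\<dots> \<longleftrightarrow> f \<in> \<phi> \<omega> \<and>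
      (\<forall>A\<in>\<X>. \<forall>\<nu>\<in>agreeing_others \<Omega> \<omega> A. restrict f A \<in> restr_set (\<phi> \<nu>) A)"
    using sub by (auto simp: mem_bracket_iff)
  also have "\<dots> \<longleftrightarrow> f \<in> \<phi> \<omega> \<and> (\<forall>A\<in>\<X>. \<forall>\<nu>\<in>\<Omega>. restrict \<nu> A = restrict \<omega> A \<longrightarrow>
      restrict f A \<in> restr_set (\<phi> \<nu>) A)"
    by (auto simp: agreeing_others_def agreeing_def restr_set_def)
  finally show ?thesis .
qed

lemma gamma_below:
  assumes "\<phi> \<in> multifunctions_below C \<Omega> \<M>" and "\<X> \<noteq> {}"
  shows "multi_le \<Omega> (gamma C \<Omega> \<X> \<M> \<phi>) \<phi>"
  unfolding multi_le_def using assms by (simp add: subset_iff mem_gamma_iff)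

lemma gamma_in_multifunctions_below:
  assumes \<phi>: "\<phi> \<in> multifunctions_below C \<Omega> \<M>" and "\<X> \<noteq> {}"
  shows "gamma C \<Omega> \<X> \<M> \<phi> \<in> multifunctions_below C \<Omega> \<M>"
proof -
  have "gamma C \<Omega> \<X> \<M> \<phi> \<in> extensional \<Omega>"
    using \<phi> by (simp add: gamma_def)
  moreover have "gamma C \<Omega> \<X> \<M> \<phi> \<omega> \<subseteq> C \<inter> \<M> \<omega>" if "\<omega> \<in> \<Omega>" for \<omega>
  proof -
    have "\<phi> \<omega> \<subseteq> C \<inter> \<M> \<omega>"
      using \<phi> that by (auto simp: multifunctions_below_def multifunctions_def multi_le_def)
    moreover have "gamma C \<Omega> \<X> \<M> \<phi> \<omega> \<subseteq> \<phi> \<omega>"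
      using gamma_below[OF assms] that by (simp add: multi_le_def)
    ultimately show ?thesis by blast
  qed
  ultimately show ?thesis
    by (simp add: multifunctions_below_def multifunctions_def multi_le_def PiE_def)
qed

lemma gamma_mono:
  assumes "\<phi> \<in> multifunctions_below C \<Omega> \<M>" "\<psi> \<in> multifunctions_below C \<Omega> \<M>"
    and le: "multi_le \<Omega> \<phi> \<psi>" and "\<X> \<noteq> {}"
  shows "multi_le \<Omega> (gamma C \<Omega> \<X> \<M> \<phi>) (gamma C \<Omega> \<X> \<M> \<psi>)"
proof -
  have pw: "\<phi> \<nu> \<subseteq> \<psi> \<nu>" if "\<nu> \<in> \<Omega>" for \<nu>
    using le that by (simp add: multi_le_def)
  have restr: "restr_set (\<phi> \<nu>) A \<subseteq> restr_set (\<psi> \<nu>) A" if "\<nu> \<in> \<Omega>" for \<nu> A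
    unfolding restr_set_def using pw[OF that] by (rule image_mono)
  show ?thesis
    unfolding multi_le_def
  proof (intro ballI subsetI)
    fix \<omega> f
    assume "\<omega> \<in> \<Omega>" and "f \<in> gamma C \<Omega> \<X> \<M> \<phi> \<omega>"
    then show "f \<in> gamma C \<Omega> \<X> \<M> \<psi> \<omega>"
      using pw restr
      unfolding mem_gamma_iff[OF assms(1) \<open>\<omega> \<in> \<Omega>\<close> \<open>\<X> \<noteq> {}\<close>]
        mem_gamma_iff[OF assms(2) \<open>\<omega> \<in> \<Omega>\<close> \<open>\<X> \<noteq> {}\<close>]
      by blast
  qed
qed

lemma gamma_fixed_iff:
  assumes \<phi>: "\<phi> \<in> multifunctions_below C \<Omega> \<M>" and "\<X> \<noteq> {}"
  shows "gamma C \<Omega> \<X> \<M> \<phi> = \<phi> \<longleftrightarrow> non_anticipating \<Omega> \<X> \<phi>"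
proof -
  have ext: "gamma C \<Omega> \<X> \<M> \<phi> \<in> extensional \<Omega>" "\<phi> \<in> extensional \<Omega>"
    using \<phi> by (auto simp: gamma_def multifunctions_below_def multifunctions_def PiE_def)
  have "gamma C \<Omega> \<X> \<M> \<phi> = \<phi> \<longleftrightarrow> (\<forall>\<omega>\<in>\<Omega>. gamma C \<Omega> \<X> \<M> \<phi> \<omega> = \<phi> \<omega>)"
    using extensionalityI[OF ext] by metis
  also have "\<dots> \<longleftrightarrow> (\<forall>\<omega>\<in>\<Omega>. \<forall>f\<in>\<phi> \<omega>. \<forall>A\<in>\<X>. \<forall>\<nu>\<in>\<Omega>. restrict \<nu> A = restrict \<omega> A \<longrightarrow>
      restrict f A \<in> restr_set (\<phi> \<nu>) A)"
  proof (intro ball_cong refl)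
    fix \<omega> assume "\<omega> \<in> \<Omega>"
    show "gamma C \<Omega> \<X> \<M> \<phi> \<omega> = \<phi> \<omega> \<longleftrightarrow> (\<forall>f\<in>\<phi> \<omega>. \<forall>A\<in>\<X>. \<forall>\<nu>\<in>\<Omega>.
        restrict \<nu> A = restrict \<omega> A \<longrightarrow> restrict f A \<in> restr_set (\<phi> \<nu>) A)"
      unfolding set_eq_iff mem_gamma_iff[OF \<phi> \<open>\<omega> \<in> \<Omega>\<close> \<open>\<X> \<noteq> {}\<close>] by blast
  qed
  also have "\<dots> \<longleftrightarrow> non_anticipating \<Omega> \<X> \<phi>"
    unfolding non_anticipating_def restr_set_def image_subset_iff by blast
  finally show ?thesis .
qed

theorem mainTheorem8:
  fixes I :: "'i set" and X :: "'x set" and Y :: "'y set"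
    and C :: "('i \<Rightarrow> 'x) set" and \<Omega> :: "('i \<Rightarrow> 'y) set"
    and \<X> :: "'i set set" and \<M> :: "('i, 'x, 'y) multifun"
  assumes "I \<noteq> {}" and "X \<noteq> {}" and "Y \<noteq> {}"
    and "C \<noteq> {}" and "C \<subseteq> (I \<rightarrow>\<^sub>E X)"
    and "\<Omega> \<noteq> {}" and "\<Omega> \<subseteq> (I \<rightarrow>\<^sub>E Y)"
    and "\<X> \<noteq> {}" and "\<X> \<subseteq> Pow I"
    and "\<M> \<in> multifunctions C \<Omega>"
  shows "gamma C \<Omega> \<X> \<M> \<in> multifunctions_below C \<Omega> \<M> \<rightarrow>\<^sub>E multifunctions_below C \<Omega> \<M>
    \<and> monotone_on (multifunctions_below C \<Omega> \<M>) (multi_le \<Omega>) (multi_le \<Omega>) (gamma C \<Omega> \<X> \<M>)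
    \<and> (\<forall>\<phi>\<in>multifunctions_below C \<Omega> \<M>. multi_le \<Omega> (gamma C \<Omega> \<X> \<M> \<phi>) \<phi>)
    \<and> {\<phi> \<in> multifunctions_below C \<Omega> \<M>. gamma C \<Omega> \<X> \<M> \<phi> = \<phi>}
        = {\<phi> \<in> multifunctions_below C \<Omega> \<M>. non_anticipating \<Omega> \<X> \<phi>}"
proof (intro conjI)
  let ?M = "multifunctions_below C \<Omega> \<M>"
  note ne = \<open>\<X> \<noteq> {}\<close>
  have "gamma C \<Omega> \<X> \<M> \<in> extensional ?M"
    by (simp add: gamma_def)
  then show "gamma C \<Omega> \<X> \<M> \<in> ?M \<rightarrow>\<^sub>E ?M"
    using gamma_in_multifunctions_below[OF _ ne] unfolding PiE_def by blast
  show "monotone_on ?M (multi_le \<Omega>) (multi_le \<Omega>) (gamma C \<Omega> \<X> \<M>)"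
    using gamma_mono[OF _ _ _ ne] by (intro monotone_onI)
  show "\<forall>\<phi>\<in>?M. multi_le \<Omega> (gamma C \<Omega> \<X> \<M> \<phi>) \<phi>"
    using gamma_below[OF _ ne] by blast
  show "{\<phi> \<in> ?M. gamma C \<Omega> \<X> \<M> \<phi> = \<phi>} = {\<phi> \<in> ?M. non_anticipating \<Omega> \<X> \<phi>}"
    using gamma_fixed_iff[OF _ ne] by blast
qed

end
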